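(* Let $r\ge 2$ be an integer. Then $\log(2^n)=O(\log(s_n^C(FS_r)))$ as $n\to\infty$.
   Context: $FS_r$ is the free semigroup of rank $r$, i.e. all non-empty words over an alphabet of $r$ letters under concatenation. $a_n^C(FS_r)$ denotes the number of (two-sided) congruences on $FS_r$ with precisely $n$ non-empty congruence classes, and $s_n^C(FS_r)=\sum_{i=1}^n a_i^C(FS_r)$. For sequences, $f(n)=O(g(n))$ means there is a constant $C>0$ with $f(n)\le C\,g(n)$ for all large $n$. $\log$ is base $2$. *)

theory Defs
  imports Complex_Main "HOL-Library.Landau_Symbols"
begin

definition semigroup_congruence ::
  "'a set \<Rightarrow> ('a \<Rightarrow> 'a \<Rightarrow> 'a) \<Rightarrow> ('a \<times> 'a) set \<Rightarrow> bool" where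
  "semigroup_congruence S f \<rho> \<longleftrightarrow>
     equiv S \<rho> \<and>
     (\<forall>x y z. (x, y) \<in> \<rho> \<longrightarrow> z \<in> S \<longrightarrow> (f z x, f z y) \<in> \<rho> \<and> (f x z, f y z) \<in> \<rho>)"

text \<open>The alphabet of \<open>r\<close> letters is \<open>{..<r}\<close>; the semigroup operation is \<open>(@)\<close>.\<close>

definition free_semigroup :: "nat \<Rightarrow> nat list set" where
  "free_semigroup r = {w. w \<noteq> [] \<and> set w \<subseteq> {..<r}}"

text \<open>
  The set counted here is finite: a congruence with \<open>n\<close> classes is the kernel of a homomorphism
  onto a semigroup structure on \<open>{..<n}\<close>, and such a homomorphism is determined by the
  images of the \<open>r\<close> letters. So \<open>card\<close> does not take its default value for infinite sets.
  The finiteness condition on the quotient only matters for \<open>n = 0\<close>.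
\<close>

definition num_congruences :: "nat \<Rightarrow> nat \<Rightarrow> nat" where
  "num_congruences r n =
     card {\<rho>. semigroup_congruence (free_semigroup r) (@) \<rho> \<and>
              finite (free_semigroup r // \<rho>) \<and> card (free_semigroup r // \<rho>) = n}"

definition sum_num_congruences :: "nat \<Rightarrow> nat \<Rightarrow> nat" where
  "sum_num_congruences r n = (\<Sum>i = 1..n. num_congruences r i)"

end

(*
  Lower bound: let a, b be two of the letters. For A \<subseteq> {0, ..., m - 1} the at most 4m words
  a^i (i > 0), b a^j, a^j b with exponents below m, together with b a^j b for j \<in> A, form a set
  closed under non-empty factors. Collapsing its complement, an ideal, to a single class gives a
  congruence with at most 4m + 1 classes, and A can be recovered from it. So there are at least
  2^m congruences with at most 4m + 1 classes.

  This bounds the cardinality in question only once finiteness is known. Every class of a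
  congruence with n classes contains a word of length at most n, since a longer word has two
  congruent prefixes and can be shortened. Hence the congruence is determined by its restriction
  to the words of length at most n + 1.
*)
theory Submission
  imports Defs
begin

section \<open>Congruences with boundedly many classes\<close>

lemma free_semigroup_append:
  "u \<noteq> [] \<Longrightarrow> v \<noteq> [] \<Longrightarrow>
     u @ v \<in> free_semigroup r \<longleftrightarrow> u \<in> free_semigroup r \<and> v \<in> free_semigroup r"
  by (auto simp: free_semigroup_def)

text \<open>Compatibility is defined only for factors from the semigroup, which lacks the empty
  word. Cutting a word into prefix and remainder can leave an empty remainder, so that case is added
  here.\<close>

lemma congruence_append_right:
  assumes "semigroup_congruence (free_semigroup r) (@) \<rho>" "(u, v) \<in> \<rho>" "set z \<subseteq> {..<r}"
  shows "(u @ z, v @ z) \<in> \<rho>"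
proof (cases "z = []")
  case False
  then have "z \<in> free_semigroup r"
    using assms(3) by (simp add: free_semigroup_def)
  then show ?thesis
    using assms(1,2) by (auto simp: semigroup_congruence_def)
qed (use assms in simp)

lemma congruent_short_word:
  assumes \<rho>: "semigroup_congruence (free_semigroup r) (@) \<rho>"
    and fin: "finite (free_semigroup r // \<rho>)"
    and w: "w \<in> free_semigroup r"
  shows "\<exists>v. (w, v) \<in> \<rho> \<and> length v \<le> card (free_semigroup r // \<rho>)"
  using w
proof (induction "length w" arbitrary: w rule: less_induct)
  case less
  let ?S = "free_semigroup r" and ?n = "card (free_semigroup r // \<rho>)"
  have eq: "equiv ?S \<rho>" using \<rho> by (simp add: semigroup_congruence_def)
  show ?case
  proof (cases "length w \<le> ?n")
    case True
    then show ?thesis using less.prems eq by (auto simp: equiv_def refl_on_def)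
  next
    case False
    have pre: "take i w \<in> ?S" if "i \<in> {1..length w}" for i
      using that less.prems set_take_subset[of i w] by (auto simp: free_semigroup_def)
    \<comment> \<open>Indices start at 1 because the empty prefix is not in the semigroup. This
      still leaves \<open>length w\<close> prefixes, more than there are classes.\<close>
    let ?g = "\<lambda>i. \<rho> `` {take i w}"
    have "?g ` {1..length w} \<subseteq> ?S // \<rho>"
      using pre by (auto intro: quotientI)
    then have "card (?g ` {1..length w}) \<le> ?n"
      by (rule card_mono[OF fin])
    then have "\<not> inj_on ?g {1..length w}"
      using False by (intro pigeonhole) simp
    then obtain i j where ij: "i \<in> {1..length w}" "j \<in> {1..length w}" "i < j" "?g i = ?g j"
      unfolding inj_on_def by (metis linorder_neqE_nat)
    have "(take j w, take i w) \<in> \<rho>"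
      using eq_equiv_class[OF ij(4)[symmetric] eq] pre ij by blast
    moreover have "set (drop j w) \<subseteq> {..<r}"
      using less.prems set_drop_subset[of j w] by (auto simp: free_semigroup_def)
    \<comment> \<open>Cutting out the letters between two congruent prefixes leaves a shorter word
      in the same class.\<close>
    ultimately have short: "(w, take i w @ drop j w) \<in> \<rho>"
      using congruence_append_right[OF \<rho>] by (metis append_take_drop_id)
    then have "take i w @ drop j w \<in> ?S"
      using eq by (auto simp: equiv_def)
    moreover have "length (take i w @ drop j w) < length w"
      using ij by auto
    ultimately obtain v where "(take i w @ drop j w, v) \<in> \<rho>" "length v \<le> ?n"
      using less.hyps by blast
    then show ?thesis
      using short eq by (meson equiv_def transD)
  qed
qed

text \<open>Only \<rho> supplies short representatives; agreement on \<open>W\<close> carries them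
  over to \<sigma>, one letter at a time. Appending a letter to a representative of length at most
  \<open>n\<close> gives length \<open>Suc n\<close>, hence the bound in \<open>W\<close>.\<close>

lemma congruence_eqI_short_words:
  fixes r n :: nat
  defines "W \<equiv> {w. set w \<subseteq> {..<r} \<and> length w \<le> Suc n}"
  assumes \<rho>: "semigroup_congruence (free_semigroup r) (@) \<rho>"
      "finite (free_semigroup r // \<rho>)" "card (free_semigroup r // \<rho>) \<le> n"
    and \<sigma>: "semigroup_congruence (free_semigroup r) (@) \<sigma>"
    and res: "\<rho> \<inter> W \<times> W = \<sigma> \<inter> W \<times> W"
  shows "\<rho> = \<sigma>"
proof -
  let ?S = "free_semigroup r"
  have eq: "equiv ?S \<rho>" "equiv ?S \<sigma>"
    using \<rho> \<sigma> by (auto simp: semigroup_congruence_def)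
  have sub: "x \<in> ?S" "y \<in> ?S" if "(x, y) \<in> \<rho> \<or> (x, y) \<in> \<sigma>" for x y
    using that eq by (auto simp: equiv_def)
  have sh: "\<exists>v. (w, v) \<in> \<rho> \<and> v \<in> ?S \<and> length v \<le> n" if "w \<in> ?S" for w
    using congruent_short_word[OF \<rho>(1,2) that] \<rho>(3) sub by fastforce
  have SW: "v \<in> W" if "v \<in> ?S" "length v \<le> Suc n" for v
    using that by (simp add: free_semigroup_def W_def)
  have res': "(x, y) \<in> \<rho> \<longleftrightarrow> (x, y) \<in> \<sigma>" if "x \<in> W" "y \<in> W" for x y
    using res that by blast
  have common: "w \<in> ?S \<Longrightarrow> \<exists>v. (w, v) \<in> \<rho> \<and> (w, v) \<in> \<sigma> \<and> length v \<le> n" for w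
  proof (induction w rule: rev_induct)
    case Nil
    then show ?case by (simp add: free_semigroup_def)
  next
    case (snoc x u)
    have x: "set [x] \<subseteq> {..<r}"
      using snoc.prems by (simp add: free_semigroup_def)
    obtain t where t: "(u @ [x], t) \<in> \<rho>" "(u @ [x], t) \<in> \<sigma>" "length t \<le> Suc n"
    proof (cases "u = []")
      case True
      then show ?thesis
        using that[of "[x]"] snoc.prems eq by (auto simp: equiv_def refl_on_def)
    next
      case False
      then have "u \<in> ?S"
        using snoc.prems by (simp add: free_semigroup_append)
      then obtain v where v: "(u, v) \<in> \<rho>" "(u, v) \<in> \<sigma>" "length v \<le> n"
        using snoc.IH by blast
      show ?thesis
        using that[of "v @ [x]"] v x congruence_append_right \<rho>(1) \<sigma> by simp
    qed
    \<comment> \<open>The word \<open>t\<close> may be one letter too long. It is shortened with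
      respect to \<rho>; both words lie in \<open>W\<close>, so \<sigma> identifies them as
      well.\<close>
    obtain v where v: "(t, v) \<in> \<rho>" "v \<in> ?S" "length v \<le> n"
      using sh t(1) sub by blast
    moreover have "t \<in> W" "v \<in> W"
      using v t sub by (auto intro: SW)
    ultimately have "(t, v) \<in> \<sigma>"
      using res' by blast
    then show ?case
      using v t eq by (meson equiv_def transD)
  qed
  \<comment> \<open>Replacing both words by their common representatives turns the question into one
    about \<open>W\<close>.\<close>
  have "(x, y) \<in> \<rho> \<longleftrightarrow> (x, y) \<in> \<sigma>" if xy: "x \<in> ?S" "y \<in> ?S" for x y
  proof -
    obtain u where u: "(x, u) \<in> \<rho>" "(x, u) \<in> \<sigma>" "length u \<le> n"
      using common xy by blast
    obtain v where v: "(y, v) \<in> \<rho>" "(y, v) \<in> \<sigma>" "length v \<le> n"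
      using common xy by blast
    have "u \<in> W" "v \<in> W"
      using SW sub(2) u(1,3) v(1,3) le_SucI by blast+
    then have "(u, v) \<in> \<rho> \<longleftrightarrow> (u, v) \<in> \<sigma>"
      by (rule res')
    moreover have "(x, y) \<in> \<tau> \<longleftrightarrow> (u, v) \<in> \<tau>"
      if "equiv ?S \<tau>" "(x, u) \<in> \<tau>" "(y, v) \<in> \<tau>" for \<tau>
      using that by (meson equiv_def symD transD)
    ultimately show ?thesis
      using u v eq by blast
  qed
  then show ?thesis
    using sub by (intro set_eqI) (metis surj_pair)
qed

lemma finite_congruences:
  "finite {\<rho>. semigroup_congruence (free_semigroup r) (@) \<rho> \<and>
              finite (free_semigroup r // \<rho>) \<and> card (free_semigroup r // \<rho>) \<le> n}"
    (is "finite ?C")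
proof -
  define W where "W = {w :: nat list. set w \<subseteq> {..<r} \<and> length w \<le> Suc n}"
  have "finite (Pow (W \<times> W))"
    using finite_lists_length_le[of "{..<r}" "Suc n"] by (simp add: W_def)
  moreover have "(\<lambda>\<rho>. \<rho> \<inter> W \<times> W) ` ?C \<subseteq> Pow (W \<times> W)"
    by blast
  ultimately have "finite ((\<lambda>\<rho>. \<rho> \<inter> W \<times> W) ` ?C)"
    by (rule finite_subset[rotated])
  moreover have "inj_on (\<lambda>\<rho>. \<rho> \<inter> W \<times> W) ?C"
  proof (rule inj_onI)
    fix \<rho> \<sigma>
    assume "\<rho> \<in> ?C" "\<sigma> \<in> ?C" "\<rho> \<inter> W \<times> W = \<sigma> \<inter> W \<times> W"
    then show "\<rho> = \<sigma>"
      using congruence_eqI_short_words[of r \<rho> n \<sigma>] unfolding W_def by blast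
  qed
  ultimately show ?thesis
    by (rule finite_imageD)
qed

text \<open>Congruences with different numbers of classes are different, so the union is disjoint;
  finiteness of each part makes cardinality additive.\<close>

lemma sum_num_congruences_eq_card:
  "sum_num_congruences r n =
     card {\<rho>. semigroup_congruence (free_semigroup r) (@) \<rho> \<and>
              finite (free_semigroup r // \<rho>) \<and> card (free_semigroup r // \<rho>) \<in> {1..n}}"
proof -
  let ?C = "\<lambda>i. {\<rho>. semigroup_congruence (free_semigroup r) (@) \<rho> \<and>
              finite (free_semigroup r // \<rho>) \<and> card (free_semigroup r // \<rho>) = i}"
  have "finite (?C i)" for i
    by (rule finite_subset[OF _ finite_congruences[of r i]]) auto
  then have "card (\<Union>i\<in>{1..n}. ?C i) = sum_num_congruences r n"
    unfolding sum_num_congruences_def num_congruences_def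
    by (intro card_UN_disjoint) auto
  moreover have "(\<Union>i\<in>{1..n}. ?C i) =
      {\<rho>. semigroup_congruence (free_semigroup r) (@) \<rho> \<and>
          finite (free_semigroup r // \<rho>) \<and> card (free_semigroup r // \<rho>) \<in> {1..n}}"
    by auto
  ultimately show ?thesis
    by simp
qed

section \<open>Rees congruences\<close>

text \<open>The parameter \<open>F\<close> is the complement of the ideal that is collapsed: it is
  the finite set that gets constructed, and its size controls the number of classes.\<close>

definition rees_congruence :: "'a set \<Rightarrow> 'a set \<Rightarrow> ('a \<times> 'a) set" where
  "rees_congruence S F = {(x, y). x \<in> S \<and> y \<in> S \<and> (x = y \<or> x \<notin> F \<and> y \<notin> F)}"

lemma equiv_rees_congruence: "equiv S (rees_congruence S F)"
  by (rule equivI) (auto simp: rees_congruence_def refl_on_def sym_def trans_def)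

text \<open>Equality can fail, when \<open>S - F\<close> is empty or \<open>F\<close> is not inside
  \<open>S\<close>, but an upper bound on the number of classes needs only the inclusion.\<close>

lemma quotient_rees_congruence:
  "S // rees_congruence S F \<subseteq> insert (S - F) ((\<lambda>w. {w}) ` F)"
  by (auto simp: quotient_def rees_congruence_def)

lemma card_quotient_rees_congruence:
  assumes "finite F"
  shows "finite (S // rees_congruence S F)" "card (S // rees_congruence S F) \<le> Suc (card F)"
proof -
  show "finite (S // rees_congruence S F)"
    by (rule finite_subset[OF quotient_rees_congruence]) (use assms in simp)
  have "card (S // rees_congruence S F) \<le> card (insert (S - F) ((\<lambda>w. {w}) ` F))"
    by (rule card_mono[OF _ quotient_rees_congruence]) (use assms in simp)
  also have "\<dots> \<le> Suc (card ((\<lambda>w. {w}) ` F))"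
    using assms by (simp add: card_insert_if)
  also have "\<dots> \<le> Suc (card F)"
    using assms by (simp add: card_image_le)
  finally show "card (S // rees_congruence S F) \<le> Suc (card F)" .
qed

text \<open>Deleting end letters repeatedly reaches every non-empty factor, so \<open>F\<close>
  contains the non-empty factors of its words. Contrapositively, a product with a factor outside
  \<open>F\<close> is outside \<open>F\<close>: the complement is an ideal.\<close>

lemma semigroup_congruence_rees_congruence:
  assumes tl: "\<And>w. w \<in> F \<Longrightarrow> tl w \<noteq> [] \<Longrightarrow> tl w \<in> F"
    and butlast: "\<And>w. w \<in> F \<Longrightarrow> butlast w \<noteq> [] \<Longrightarrow> butlast w \<in> F"
  shows "semigroup_congruence (free_semigroup r) (@) (rees_congruence (free_semigroup r) F)"
proof -
  have suffix: "z @ x \<in> F \<Longrightarrow> x \<noteq> [] \<Longrightarrow> x \<in> F" for z x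
    by (induction z) (use tl in force)+
  have prefix: "x @ z \<in> F \<Longrightarrow> x \<noteq> [] \<Longrightarrow> x \<in> F" for z x
  proof (induction z rule: rev_induct)
    case (snoc c z)
    then show ?case using butlast[of "x @ z @ [c]"] by (simp add: butlast_append)
  qed simp
  have "x \<noteq> []" if "x \<in> free_semigroup r" for x
    using that by (simp add: free_semigroup_def)
  then have "z @ x \<notin> F" "x @ z \<notin> F" if "x \<in> free_semigroup r" "x \<notin> F" for x z
    using that suffix prefix by blast+
  moreover have "u @ v \<in> free_semigroup r"
    if "u \<in> free_semigroup r" "v \<in> free_semigroup r" for u v
    using that by (auto simp: free_semigroup_def)
  ultimately show ?thesis
    unfolding semigroup_congruence_def
    by (simp add: equiv_rees_congruence) (auto simp: rees_congruence_def)
qed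

section \<open>The factor-closed sets of words encoding subsets of \<open>{..<m}\<close>\<close>

text \<open>The letters a and b are \<open>0\<close> and \<open>1\<close>. Exponent 0 is left out of
  the first family, where it would give the empty word.\<close>

definition sparse_words :: "nat \<Rightarrow> nat set \<Rightarrow> nat list set" where
  "sparse_words m A =
     (\<lambda>i. replicate i 0) ` {1..<m} \<union> (\<lambda>j. 1 # replicate j 0) ` {..<m} \<union>
     (\<lambda>j. replicate j 0 @ [1]) ` {..<m} \<union> (\<lambda>j. 1 # replicate j 0 @ [1]) ` A"

lemma card_sparse_words:
  assumes "A \<subseteq> {..<m}"
  shows "finite (sparse_words m A)" "card (sparse_words m A) \<le> 4 * m"
proof -
  have fin: "finite A" and A: "card A \<le> m"
    using assms finite_subset card_mono[OF _ assms] by auto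
  show "finite (sparse_words m A)"
    using fin by (simp add: sparse_words_def)
  let ?P = "(\<lambda>i. replicate i (0::nat)) ` {1..<m}"
    and ?Q = "(\<lambda>j. 1 # replicate j (0::nat)) ` {..<m}"
    and ?R = "(\<lambda>j. replicate j (0::nat) @ [1]) ` {..<m}"
    and ?T = "(\<lambda>j. 1 # replicate j (0::nat) @ [1]) ` A"
  have "card ?P \<le> m" "card ?Q \<le> m" "card ?R \<le> m" "card ?T \<le> m"
    using card_image_le[of "{1..<m}" "\<lambda>i. replicate i (0::nat)"]
      card_image_le[of "{..<m}" "\<lambda>j. 1 # replicate j (0::nat)"]
      card_image_le[of "{..<m}" "\<lambda>j. replicate j (0::nat) @ [1]"]
      card_image_le[OF fin, of "\<lambda>j. 1 # replicate j (0::nat) @ [1]"] A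
    by auto
  moreover have "card (sparse_words m A) \<le> card ?P + card ?Q + card ?R + card ?T"
    unfolding sparse_words_def
    by (meson add_le_mono1 card_Un_le le_trans)
  ultimately show "card (sparse_words m A) \<le> 4 * m"
    by linarith
qed

text \<open>Without its first letter, a power of a or a word a^j b stays in its family, b a^j
  becomes a^j, and b a^j b becomes a^j b. The last case uses
  \<open>A \<subseteq> {..<m}\<close>.\<close>

lemma tl_sparse_words:
  assumes "A \<subseteq> {..<m}" "w \<in> sparse_words m A" "tl w \<noteq> []"
  shows "tl w \<in> sparse_words m A"
proof -
  have "w \<in> (\<lambda>i. replicate i 0) ` {1..<m} \<or> w \<in> (\<lambda>j. 1 # replicate j 0) ` {..<m} \<or>
      w \<in> (\<lambda>j. replicate j 0 @ [1]) ` {..<m} \<or> w \<in> (\<lambda>j. 1 # replicate j 0 @ [1]) ` A"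
    using assms(2) by (auto simp: sparse_words_def)
  then show ?thesis
  proof (elim disjE imageE)
    fix i assume "w = replicate i 0" "i \<in> {1..<m}"
    then have "tl w = replicate (i - 1) 0" "i - 1 \<in> {1..<m}"
      using assms(3) by (cases "i = 1"; auto)+
    then show ?thesis unfolding sparse_words_def by blast
  next
    fix j assume "w = 1 # replicate j 0" "j \<in> {..<m}"
    then have "tl w = replicate j 0" "j \<in> {1..<m}"
      using assms(3) by (cases j; auto)+
    then show ?thesis unfolding sparse_words_def by blast
  next
    fix j assume "w = replicate j 0 @ [1]" "j \<in> {..<m}"
    then have "tl w = replicate (j - 1) 0 @ [1]" "j - 1 \<in> {..<m}"
      using assms(3) by (cases j; auto)+
    then show ?thesis unfolding sparse_words_def by blast
  next
    fix j assume "w = 1 # replicate j 0 @ [1]" "j \<in> A"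
    then have "tl w = replicate j 0 @ [1]" "j \<in> {..<m}"
      using assms(1) by auto
    then show ?thesis unfolding sparse_words_def by blast
  qed
qed

text \<open>Reversal fixes the words of the first and last families and swaps the two middle
  families. It reduces deletion of the last letter to deletion of the first.\<close>

lemma rev_sparse_words: "w \<in> sparse_words m A \<Longrightarrow> rev w \<in> sparse_words m A"
  unfolding sparse_words_def by auto

lemma butlast_sparse_words:
  assumes "A \<subseteq> {..<m}" "w \<in> sparse_words m A" "butlast w \<noteq> []"
  shows "butlast w \<in> sparse_words m A"
proof -
  have "butlast w = rev (tl (rev w))"
    by (metis butlast_rev rev_rev_ident)
  then show ?thesis
    using assms tl_sparse_words rev_sparse_words by (metis rev.simps(1))
qed

text \<open>Two occurrences of \<open>1\<close> single out the last family, and within it the length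
  determines the exponent.\<close>

lemma sparse_words_iff: "1 # replicate j 0 @ [1] \<in> sparse_words m A \<longleftrightarrow> j \<in> A"
proof -
  have "count_list (1 # replicate j 0 @ [1]) (1::nat) = 2"
    by (simp add: count_list_append count_list_0_iff)
  moreover have "count_list (replicate i 0) (1::nat) = 0"
    "count_list (1 # replicate i 0) (1::nat) = 1"
    "count_list (replicate i 0 @ [1]) (1::nat) = 1" for i
    by (simp_all add: count_list_append count_list_0_iff)
  ultimately have ne: "1 # replicate j 0 @ [1] \<noteq> replicate i (0::nat)"
    "1 # replicate j 0 @ [1] \<noteq> 1 # replicate i (0::nat)"
    "1 # replicate j 0 @ [1] \<noteq> replicate i (0::nat) @ [1]" for i
    by (metis zero_neq_numeral one_eq_numeral_iff num.distinct(1))+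
  have "i = j" if "1 # replicate j 0 @ [1] = 1 # replicate i (0::nat) @ [1]" for i
    using arg_cong[OF that, of length] by simp
  then show ?thesis
    using ne unfolding sparse_words_def by blast
qed

text \<open>This provides a word in the collapsed class that does not depend on
  \<open>A\<close>.\<close>

lemma cube_notin_sparse_words: "[1, 1, 1] \<notin> sparse_words m A"
proof -
  have "\<not> (\<exists>j. [1, 1, 1] = 1 # replicate j (0::nat) @ [1])"
  proof
    assume "\<exists>j. [1, 1, 1] = 1 # replicate j (0::nat) @ [1]"
    then obtain j where "[1] = replicate j (0::nat)" by auto
    then show False by (cases j) auto
  qed
  moreover have "[1, 1, 1] \<noteq> replicate j (0::nat)" "[1, 1, 1] \<noteq> 1 # replicate j (0::nat)"
    "[1, 1, 1] \<noteq> replicate j (0::nat) @ [1]" for j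
    by (cases j; auto)+
  ultimately show ?thesis
    unfolding sparse_words_def by blast
qed

lemma inj_rees_congruence_sparse_words:
  assumes "2 \<le> r"
  shows "inj (\<lambda>A. rees_congruence (free_semigroup r) (sparse_words m A))"
proof (rule injI)
  \<comment> \<open>Membership of \<open>j\<close> is read off from the congruence alone: b a^j b is
    congruent to the collapsed word bbb exactly when it is itself collapsed.\<close>
  have iff: "j \<in> A \<longleftrightarrow>
      (1 # replicate j 0 @ [1], [1, 1, 1])
        \<notin> rees_congruence (free_semigroup r) (sparse_words m A)" for j A
  proof -
    have "[1, 1, 1] \<in> free_semigroup r" "1 # replicate j 0 @ [1] \<in> free_semigroup r"
      using assms by (auto simp: free_semigroup_def)
    then show ?thesis
      using sparse_words_iff[of j m A] cube_notin_sparse_words[of m A]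
      unfolding rees_congruence_def by auto
  qed
  fix A B :: "nat set"
  assume "rees_congruence (free_semigroup r) (sparse_words m A) =
    rees_congruence (free_semigroup r) (sparse_words m B)"
  then show "A = B"
    using iff by (intro set_eqI) metis
qed

section \<open>The lower bound and its asymptotic form\<close>

lemma sum_num_congruences_ge:
  assumes "2 \<le> r" "4 * m + 1 \<le> n"
  shows "2 ^ m \<le> sum_num_congruences r n"
proof -
  let ?S = "free_semigroup r"
  let ?\<rho> = "\<lambda>A. rees_congruence ?S (sparse_words m A)"
  let ?C = "{\<rho>. semigroup_congruence ?S (@) \<rho> \<and> finite (?S // \<rho>) \<and> card (?S // \<rho>) \<in> {1..n}}"
  have "?\<rho> A \<in> ?C" if A: "A \<subseteq> {..<m}" for A
  proof -
    note fin = card_quotient_rees_congruence[OF card_sparse_words(1)[OF A], of ?S]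
    \<comment> \<open>The sum starts at one class, so the quotient must be shown to be
      non-empty.\<close>
    have "[0] \<in> ?S"
      using assms(1) by (auto simp: free_semigroup_def)
    then have "?S // ?\<rho> A \<noteq> {}"
      by (auto simp: quotient_def)
    then have "1 \<le> card (?S // ?\<rho> A)"
      using fin(1) by (simp add: Suc_le_eq card_gt_0_iff)
    moreover have "card (?S // ?\<rho> A) \<le> n"
      using fin(2) card_sparse_words(2)[OF A] assms(2) by linarith
    moreover have "semigroup_congruence ?S (@) (?\<rho> A)"
      using tl_sparse_words[OF A] butlast_sparse_words[OF A]
      by (rule semigroup_congruence_rees_congruence)
    ultimately show ?thesis
      using fin(1) by simp
  qed
  then have "?\<rho> ` Pow {..<m} \<subseteq> ?C"
    by blast
  moreover have "finite ?C"
    by (rule finite_subset[OF _ finite_congruences[of r n]]) auto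
  ultimately have "card (?\<rho> ` Pow {..<m}) \<le> card ?C"
    by (intro card_mono)
  moreover have "card (?\<rho> ` Pow {..<m}) = 2 ^ m"
    using inj_on_subset[OF inj_rees_congruence_sparse_words[OF assms(1), of m]]
    by (subst card_image) (auto simp: card_Pow)
  ultimately show ?thesis
    by (simp add: sum_num_congruences_eq_card)
qed

theorem proposition7p1:
  fixes r :: nat
  assumes "2 \<le> r"
  shows "(\<lambda>n::nat. log 2 (2 ^ n)) \<in> O(\<lambda>n. log 2 (real (sum_num_congruences r n)))"
proof (rule bigoI[where c = 8])
  have "norm (log 2 (2 ^ n)) \<le> 8 * norm (log 2 (real (sum_num_congruences r n)))"
    if n: "8 \<le> n" for n
  proof -
    \<comment> \<open>This is the largest \<open>m\<close> with \<open>4 * m + 1 \<le> n\<close>. It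
      satisfies \<open>4 * m \<ge> n - 4\<close>, so \<open>8 * m \<ge> 2 * n - 8\<close>, which is
      at least \<open>n\<close> once \<open>8 \<le> n\<close>; hence the constant 8 and the
      threshold 8.\<close>
    define m where "m = (n - 1) div 4"
    have m: "4 * m + 1 \<le> n" "n \<le> 8 * m"
      using n by (auto simp: m_def)
    have "real (2 ^ m) \<le> real (sum_num_congruences r n)"
      using sum_num_congruences_ge[OF assms m(1)] by (simp only: of_nat_le_iff)
    then have "log 2 (2 ^ m) \<le> log 2 (real (sum_num_congruences r n))"
      by (intro log_mono) auto
    then have "real m \<le> log 2 (real (sum_num_congruences r n))"
      by (simp add: log_nat_power)
    moreover have "real n \<le> 8 * real m"
      using m(2) by linarith
    \<comment> \<open>The logarithm on the right is at least \<open>real m\<close>, hence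
      non-negative, so its norm is the logarithm itself.\<close>
    ultimately show ?thesis
      by (simp add: log_nat_power)
  qed
  then show "\<forall>\<^sub>F n in sequentially. norm (log 2 (2 ^ n)) \<le>
      8 * norm (log 2 (real (sum_num_congruences r n)))"
    using eventually_ge_at_top[of 8] by (rule eventually_mono[rotated])
qed

end
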